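(* Let $K$ be an algebraically closed field, $S=K[x_0,x_1,x_2,x_3]$, and let $d\ge 2$ be an integer. Put $H=x_0^{d-1}-x_3^{d-1}$, $I=\langle x_2^2-x_1x_3,\; x_1x_2-x_0x_3,\; x_1^2-x_0x_2\rangle$, and $$I_{D_0}=I+\langle (x_2-x_1)H\rangle,\quad I_{D_1}=I+\langle x_2H,\,x_1H\rangle,\quad I_{D_2}=I+\langle x_2H,\,x_1H,\,x_0H\rangle .$$ Then (1) $\operatorname{sdefect}(I_{D_1},m)>0$ for every integer $m\ge 3$; (2) $\operatorname{sdefect}(I_{D_j},m)>0$ for $j=0,2$ and every integer $m\ge 2$.
   Context: For a homogeneous ideal $J\subset S$ and $m\ge1$, the $m$-th symbolic power is $J^{(m)}=S\cap\bigcap_{\mathfrak{p}\in\operatorname{Ass}(J)}(J^m)_{\mathfrak{p}}$, the intersection being over all associated primes $\mathfrak p$ of $J$; one always has $J^m\subseteq J^{(m)}$. For an integer $m\ge 2$, the $m$-th symbolic defect $\operatorname{sdefect}(J,m)$ is the number of minimal generators of the $S$-module $J^{(m)}/J^m$. *)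

theory Defs
  imports
    "HOL-Computational_Algebra.Computational_Algebra"
    "HOL-Library.Poly_Mapping"
    "HOL-Library.Numeral_Type"
    "HOL-Library.Set_Algebras"
    "HOL-Library.Extended_Nat"
begin

section \<open>Ideals of a commutative ring\<close>

text \<open>
  A commutative ring is regarded as a module over itself: its ideals are the sets satisfying
  \<open>ideal.subspace\<close>, and \<open>ideal.span X\<close> is the ideal generated by \<open>X\<close>.
\<close>

interpretation ideal: module "(*) :: 'a::comm_ring_1 \<Rightarrow> 'a \<Rightarrow> 'a"
  by standard (simp_all add: algebra_simps)

declare ideal.scale_scale [simp del]

primrec ideal_power :: "'a::comm_ring_1 set \<Rightarrow> nat \<Rightarrow> 'a set" where
  "ideal_power J 0 = UNIV"
| "ideal_power J (Suc m) = ideal.span {a * b | a b. a \<in> J \<and> b \<in> ideal_power J m}"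

definition prime_ideal :: "'a::comm_ring_1 set \<Rightarrow> bool" where
  "prime_ideal P \<longleftrightarrow>
     ideal.subspace P \<and> P \<noteq> UNIV \<and> (\<forall>a b. a * b \<in> P \<longrightarrow> a \<in> P \<or> b \<in> P)"

text \<open>
  The associated primes of an ideal \<open>J\<close> of \<open>S\<close> are those of the module \<open>S/J\<close>, i.e. the prime
  ideals that are annihilators \<open>(J : f)\<close> of a residue class \<open>f + J\<close>.
\<close>

definition associated_primes :: "'a::comm_ring_1 set \<Rightarrow> 'a set set" where
  "associated_primes J = {P. prime_ideal P \<and> (\<exists>f. P = {g. g * f \<in> J})}"

text \<open>The localisation \<open>J\<^sub>P\<close> of \<open>J\<close> at \<open>P\<close>, as a subset of the field of fractions.\<close>

definition localized_ideal :: "'a::idom set \<Rightarrow> 'a set \<Rightarrow> 'a fract set" where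
  "localized_ideal J P = {Fract a s | a s. a \<in> J \<and> s \<notin> P}"

text \<open>The intersection with the ring itself is the preimage under \<open>to_fract\<close>.\<close>

definition symbolic_power :: "'a::idom set \<Rightarrow> nat \<Rightarrow> 'a set" where
  "symbolic_power J m =
     to_fract -` (\<Inter>P\<in>associated_primes J. localized_ideal (ideal_power J m) P)"

section \<open>Symbolic defect\<close>

text \<open>
  For ideals \<open>N \<subseteq> M\<close>, the quotient module \<open>M/N\<close> is the set of cosets \<open>f + N\<close> with \<open>f \<in> M\<close>;
  the submodule generated by the cosets of the elements of \<open>G\<close> consists of the cosets of
  the elements of \<open>ideal.span G\<close>.
\<close>

definition quotient_module :: "'a::comm_ring_1 set \<Rightarrow> 'a set \<Rightarrow> 'a set set" where
  "quotient_module M N = (\<lambda>f. f +o N) ` M"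

definition generates_quotient :: "'a::comm_ring_1 set \<Rightarrow> 'a set \<Rightarrow> 'a set \<Rightarrow> bool" where
  "generates_quotient G M N \<longleftrightarrow>
     G \<subseteq> M \<and> quotient_module (ideal.span G) N = quotient_module M N"

text \<open>
  The minimal number of generators of \<open>M/N\<close>; it is \<open>\<infinity>\<close> if \<open>M/N\<close> is not finitely generated, which
  does not happen over a Noetherian ring.  For a graded module over a polynomial ring over a
  field it agrees with the number of elements of any minimal homogeneous generating set.
\<close>

definition num_generators :: "'a::comm_ring_1 set \<Rightarrow> 'a set \<Rightarrow> enat" where
  "num_generators M N = (INF G \<in> {G. finite G \<and> generates_quotient G M N}. enat (card G))"

definition sdefect :: "'a::idom set \<Rightarrow> nat \<Rightarrow> enat" where
  "sdefect J m = num_generators (symbolic_power J m) (ideal_power J m)"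

section \<open>The ideals in four variables\<close>

text \<open>
  \<open>K[x\<^sub>0, x\<^sub>1, x\<^sub>2, x\<^sub>3]\<close>: finitely supported functions from exponent vectors to coefficients.
  The index type \<open>4\<close> has exactly the elements \<open>0, 1, 2, 3\<close>.
\<close>

type_synonym 'k poly4 = "(4 \<Rightarrow>\<^sub>0 nat) \<Rightarrow>\<^sub>0 'k"

definition X :: "4 \<Rightarrow> 'k::field poly4" where
  "X i = Poly_Mapping.single (Poly_Mapping.single i 1) 1"

definition H :: "nat \<Rightarrow> 'k::field poly4" where
  "H d = X 0 ^ (d - 1) - X 3 ^ (d - 1)"

definition gens_I :: "'k::field poly4 set" where
  "gens_I = {X 2 ^ 2 - X 1 * X 3, X 1 * X 2 - X 0 * X 3, X 1 ^ 2 - X 0 * X 2}"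

definition I_D0 :: "nat \<Rightarrow> 'k::field poly4 set" where
  "I_D0 d = ideal.span gens_I + ideal.span {(X 2 - X 1) * H d}"

definition I_D1 :: "nat \<Rightarrow> 'k::field poly4 set" where
  "I_D1 d = ideal.span gens_I + ideal.span {X 2 * H d, X 1 * H d}"

definition I_D2 :: "nat \<Rightarrow> 'k::field poly4 set" where
  "I_D2 d = ideal.span gens_I + ideal.span {X 2 * H d, X 1 * H d, X 0 * H d}"

end

theory Submission
  imports Defs
begin

text \<open>
  Write \<open>x\<^sub>i\<close> for \<open>X i\<close>, \<open>Q\<^sub>0, Q\<^sub>1, Q\<^sub>2\<close> for the generators of the ideal \<open>I\<close> of the twisted cubic, and
  \<open>(s : t)\<close> for the parameter of that curve, so that \<open>x\<^sub>0, x\<^sub>1, x\<^sub>2, x\<^sub>3\<close> restrict to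
  \<open>s\<^sup>3, s\<^sup>2t, st\<^sup>2, t\<^sup>3\<close>.  A symbolic defect is positive as soon as the symbolic power contains an
  element outside the ordinary power, so it is enough to exhibit one such element for each of the
  three ideals \<open>J\<close> and each \<open>m\<close>.

  Membership in the symbolic power.  The ring \<open>S/I\<close> is free over \<open>K[x\<^sub>0, x\<^sub>3]\<close> with basis
  \<open>1, x\<^sub>1, x\<^sub>2\<close>, and this shows that \<open>x\<^sub>0 h \<in> J\<close> and \<open>x\<^sub>3 h \<in> J\<close> together imply \<open>h \<in> J\<close>
  (\<open>unmixed_D0\<close>, \<open>unmixed_D1\<close>, \<open>unmixed_D2\<close>).  Hence no associated prime of \<open>J\<close> contains both
  \<open>x\<^sub>0\<close> and \<open>x\<^sub>3\<close>, and an element belongs to the symbolic power once its multiples by a power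
  of \<open>x\<^sub>0\<close> and by a power of \<open>x\<^sub>3\<close> lie in the ordinary power (\<open>symbolic_powerI\<close>).

  Where the elements come from.  The conormal module \<open>I/I\<^sup>2\<close> embeds into pairs of binary forms by
  \<open>Q\<^sub>0 \<mapsto> (t, 0)\<close>, \<open>Q\<^sub>1 \<mapsto> (s, t)\<close>, \<open>Q\<^sub>2 \<mapsto> (0, s)\<close>; the two linear relations between the
  \<open>Q\<^sub>i\<close> become \<open>s\<^sup>2 Q\<^sub>0 - s t Q\<^sub>1 + t\<^sup>2 Q\<^sub>2 = 0\<close>.  The pair \<open>e = (s, 0)\<close> is not in the span
  of the three images, but all \<open>x\<^sub>i e\<close> are classes of elements of \<open>I\<close>:
  \<open>x\<^sub>0 e = x\<^sub>0 Q\<^sub>1 - x\<^sub>1 Q\<^sub>2\<close>, \<open>x\<^sub>1 e = x\<^sub>0 Q\<^sub>0\<close>, \<open>x\<^sub>2 e = x\<^sub>1 Q\<^sub>0\<close>, \<open>x\<^sub>3 e = x\<^sub>2 Q\<^sub>0\<close>.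
  So \<open>e\<close> is a section of the conormal sheaf that does not come from \<open>I\<close>, while its product with
  any form of positive degree does.  The three witnesses are built from \<open>e\<close> and from the companion
  section \<open>Q\<^sub>1 - e = (0, t)\<close>; larger \<open>m\<close> are reached by multiplying a witness
  with a power of one of the generators of \<open>J\<close>.

  Failure of membership in the ordinary power.  Restrict to the line joining the origin of affine
  four-space to the point \<open>(1, c, c\<^sup>2, c\<^sup>3)\<close>.  The \<open>Q\<^sub>i\<close> vanish there and the other generators of
  \<open>J\<close> have degree \<open>d\<close>, so \<open>J\<^sup>m\<close> restricts into the multiples of \<open>x ^ (d * m)\<close>; the elements
  exhibited for \<open>I_D1\<close> and \<open>I_D2\<close> restrict to a nonzero multiple of \<open>x ^ (d * m - 1)\<close>
  (\<open>witness_D1_notin\<close>, \<open>witness_D2_notin\<close>).  The element exhibited for \<open>I_D0\<close> lies in \<open>I\<close>, so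
  first derivatives transversal to the cubic are needed: membership would make \<open>e\<close> equal, at two
  distinct points of the curve, to a fixed linear combination of the \<open>Q\<^sub>i\<close>, which is impossible
  (\<open>witness_D0_notin\<close>).
\<close>

section \<open>Substitution homomorphisms\<close>

locale ring_map =
  fixes f :: "'a::comm_ring_1 \<Rightarrow> 'b::comm_ring_1"
  assumes add: "f (a + b) = f a + f b"
    and mult: "f (a * b) = f a * f b"
    and one: "f 1 = 1"
begin

lemma zero: "f 0 = 0"
  using add[of 0 0] by simp

lemma uminus: "f (- a) = - f a"
  using add[of a "- a"] by (simp add: zero eq_neg_iff_add_eq_0 add.commute)

lemma diff: "f (a - b) = f a - f b"
  using add[of a "- b"] by (simp add: uminus)

lemma power: "f (a ^ n) = f a ^ n"
  by (induction n) (simp_all add: one mult)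

lemmas simps = add mult one zero diff power

end

text \<open>
  \<open>eval C v\<close> is the homomorphism out of the polynomial ring that acts as \<open>C\<close> on the
  coefficients and substitutes \<open>v i\<close> for \<open>X i\<close>.  The coefficient map is a parameter because several
  different target rings occur.
\<close>

definition eval :: "('k::field \<Rightarrow> 'r) \<Rightarrow> (4 \<Rightarrow> 'r) \<Rightarrow> 'k poly4 \<Rightarrow> 'r::comm_ring_1" where
  "eval C v p =
     (\<Sum>e\<in>Poly_Mapping.keys p. C (Poly_Mapping.lookup p e) * (\<Prod>i\<in>UNIV. v i ^ Poly_Mapping.lookup e i))"

lemma poly4_induct [case_names single add]:
  assumes single: "\<And>e a. P (Poly_Mapping.single e a)"
    and add: "\<And>p q. P p \<Longrightarrow> P q \<Longrightarrow> P (p + q)"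
  shows "P (p :: 'k::field poly4)"
proof (induction p rule: update_induct)
  case const
  show ?case using single[of 0 0] by simp
next
  case (update p e a)
  have "Poly_Mapping.update e a p = p + Poly_Mapping.single e a"
    using update(1)
    by (intro poly_mapping_eqI)
       (auto simp: lookup_update lookup_add lookup_single in_keys_iff when_def)
  then show ?case using single add update by simp
qed

context
  fixes C :: "'k::field \<Rightarrow> 'r::comm_ring_1" and v :: "4 \<Rightarrow> 'r"
  assumes C: "ring_map C"
begin

interpretation C: ring_map C by (fact C)

lemma eval_superset:
  assumes "finite A" "Poly_Mapping.keys p \<subseteq> A"
  shows "eval C v p = (\<Sum>e\<in>A. C (Poly_Mapping.lookup p e) * (\<Prod>i\<in>UNIV. v i ^ Poly_Mapping.lookup e i))"
  unfolding eval_def using assms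
  by (intro sum.mono_neutral_left) (auto simp: in_keys_iff C.zero)

lemma eval_add: "eval C v (p + q) = eval C v p + eval C v q"
proof -
  let ?A = "Poly_Mapping.keys p \<union> Poly_Mapping.keys q"
  have "eval C v (p + q) =
      (\<Sum>e\<in>?A. C (Poly_Mapping.lookup (p + q) e) * (\<Prod>i\<in>UNIV. v i ^ Poly_Mapping.lookup e i))"
    by (intro eval_superset) (use Poly_Mapping.keys_add[of p q] in auto)
  then show ?thesis
    by (simp add: lookup_add C.add distrib_right sum.distrib
      eval_superset[of ?A p] eval_superset[of ?A q])
qed

lemma eval_single: "eval C v (Poly_Mapping.single e a) = C a * (\<Prod>i\<in>UNIV. v i ^ Poly_Mapping.lookup e i)"
  by (subst eval_superset[of "{e}"]) auto

lemma eval_mult: "eval C v (p * q) = eval C v p * eval C v q"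
proof (induction p rule: poly4_induct)
  case p: (single e a)
  show ?case
  proof (induction q rule: poly4_induct)
    case (single e' b)
    then show ?case
      by (simp add: mult_single eval_single C.mult lookup_add power_add prod.distrib algebra_simps)
  qed (simp_all add: eval_add distrib_left)
qed (simp_all add: eval_add distrib_right)

lemma ring_map_eval: "ring_map (eval C v)"
  by standard
    (simp_all add: eval_add eval_mult eval_single C.one flip: single_one)

lemma eval_const: "eval C v (Poly_Mapping.single 0 a) = C a"
  by (simp add: eval_single)

lemma eval_X: "eval C v (X i) = v i"
proof -
  have "(\<Prod>j\<in>UNIV. v j ^ Poly_Mapping.lookup (Poly_Mapping.single i (1::nat)) j)
      = (\<Prod>j\<in>UNIV. if j = i then v i else 1)"
    by (rule prod.cong) (auto simp: lookup_single when_def)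
  then show ?thesis by (simp add: X_def eval_single C.one)
qed

end

lemma index_cases: "i = 0 \<or> i = 1 \<or> i = 2 \<or> i = (3::4)"
proof (induct i)
  case (of_int z)
  then have "z = 0 \<or> z = 1 \<or> z = 2 \<or> z = 3" by fastforce
  then show ?case by auto
qed

lemma poly4_ring_induct [case_names const X add mult]:
  assumes const: "\<And>a. P (Poly_Mapping.single 0 a)"
    and X: "\<And>i. P (X i)"
    and add: "\<And>p q. P p \<Longrightarrow> P q \<Longrightarrow> P (p + q)"
    and mult: "\<And>p q. P p \<Longrightarrow> P q \<Longrightarrow> P (p * q)"
  shows "P (p :: 'k::field poly4)"
proof (induction p rule: poly4_induct)
  case (single e a)
  have one: "P 1" using const[of 1] by simp
  have pow: "P (X i ^ n)" for i n by (induction n) (auto intro: one mult X)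
  have prod: "P (\<Prod>i\<in>A. X i ^ Poly_Mapping.lookup e i)" if "finite A" for A
    using that by induction (auto intro: one mult pow)
  have X_power: "X i ^ n = Poly_Mapping.single (Poly_Mapping.single i n) (1::'k)" for i n
    by (induction n) (auto simp: X_def mult_single single_add[symmetric])
  have "(\<Prod>i\<in>A. X i ^ Poly_Mapping.lookup e i)
      = Poly_Mapping.single (\<Sum>i\<in>A. Poly_Mapping.single i (Poly_Mapping.lookup e i)) (1::'k)"
    if "finite A" for A
    using that by induction (auto simp: X_power mult_single)
  moreover have "(\<Sum>i\<in>UNIV. Poly_Mapping.single i (Poly_Mapping.lookup e i)) = e"
    by (rule poly_mapping_eqI) (simp add: lookup_sum lookup_single when_def)
  ultimately have "Poly_Mapping.single e a = Poly_Mapping.single 0 a * (\<Prod>i\<in>UNIV. X i ^ Poly_Mapping.lookup e i)"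
    by (simp add: mult_single)
  then show ?case using const mult prod by simp
qed (fact add)

section \<open>Powers and symbolic powers of ideals\<close>

lemma subspace_ideal_power: "ideal.subspace (ideal_power J m)"
  by (cases m) auto

lemma ideal_power_Suc_mult: "a \<in> J \<Longrightarrow> b \<in> ideal_power J m \<Longrightarrow> a * b \<in> ideal_power J (Suc m)"
  by (auto intro: ideal.span_base)

lemma ideal_power_mult: "a \<in> J \<Longrightarrow> b \<in> ideal_power J m \<Longrightarrow> a ^ k * b \<in> ideal_power J (k + m)"
proof (induction k)
  case (Suc k)
  then show ?case using ideal_power_Suc_mult[of a J "a ^ k * b" "k + m"] by (simp add: mult.assoc)
qed simp

lemma ideal_power_2: "a \<in> J \<Longrightarrow> b \<in> J \<Longrightarrow> a * b \<in> ideal_power J 2"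
  using ideal_power_Suc_mult[of a J b 1] ideal_power_Suc_mult[of b J 1 0]
  by (simp add: numeral_2_eq_2)

lemma ideal_power_3: "a \<in> J \<Longrightarrow> b \<in> J \<Longrightarrow> c \<in> J \<Longrightarrow> a * b * c \<in> ideal_power J 3"
  using ideal_power_Suc_mult[of a J "b * c" 2] ideal_power_2[of b J c]
  by (simp add: numeral_3_eq_3 numeral_2_eq_2 mult.assoc)

text \<open>
  A homomorphism that sends the generators of an ideal to multiples of \<open>y\<close> gives a lower bound
  on the order in \<open>y\<close> of every element of a power; this is the source of all degree arguments.
\<close>

lemma dvd_ideal_power:
  assumes f: "ring_map f" and gen: "\<And>g. g \<in> G \<Longrightarrow> y dvd f g" and a: "a \<in> ideal_power (ideal.span G) m"
  shows "y ^ m dvd f a"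
proof -
  interpret ring_map f by (fact f)
  have base: "y dvd f g" if "g \<in> ideal.span G" for g
    using that by (induction rule: ideal.span_induct_alt) (auto simp: simps gen intro: dvd_mult dvd_add)
  show ?thesis using a
  proof (induction m arbitrary: a)
    case (Suc m)
    from Suc.prems show ?case unfolding ideal_power.simps
    proof (induction rule: ideal.span_induct_alt)
      case (step c ab z)
      then obtain a b where "ab = a * b" "a \<in> ideal.span G" "b \<in> ideal_power (ideal.span G) m"
        by blast
      then have "y * y ^ m dvd f ab" by (simp add: mult mult_dvd_mono base Suc.IH)
      with step show ?case by (simp add: add mult)
    qed (simp add: zero)
  qed simp
qed

text \<open>
  The first assumption keeps \<open>x\<close> and \<open>y\<close> from lying together in an associated prime
  \<open>P = (J : h)\<close>, since then \<open>h \<in> J\<close> and \<open>P\<close> would be the unit ideal.  So one of the two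
  multipliers becomes invertible in each localisation.
\<close>

lemma symbolic_powerI:
  fixes J :: "'a::idom set"
  assumes unmixed: "\<And>h. x * h \<in> J \<Longrightarrow> y * h \<in> J \<Longrightarrow> h \<in> J"
    and x: "x ^ k * f \<in> ideal_power J m" and y: "y ^ l * f \<in> ideal_power J m"
  shows "f \<in> symbolic_power J m"
proof -
  have "to_fract f \<in> localized_ideal (ideal_power J m) P" if P: "P \<in> associated_primes J" for P
  proof -
    from P obtain h where prime: "prime_ideal P" and h: "P = {g. g * h \<in> J}"
      by (auto simp: associated_primes_def)
    have sub: "ideal.subspace P" and "P \<noteq> UNIV" using prime by (auto simp: prime_ideal_def)
    have one: "1 \<notin> P"
    proof
      assume "1 \<in> P"
      then have "g \<in> P" for g using ideal.subspace_scale[OF sub, of 1 g] by simp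
      with \<open>P \<noteq> UNIV\<close> show False by auto
    qed
    have pow: "z ^ n \<notin> P" if "z \<notin> P" for z n
      using that one prime by (induction n) (auto simp: prime_ideal_def)
    have "x \<notin> P \<or> y \<notin> P" using unmixed[of h] one h by auto
    then obtain s where s: "s \<notin> P" "s * f \<in> ideal_power J m" using pow x y by blast
    then have "s \<noteq> 0" using ideal.subspace_0[OF sub] by auto
    then have "to_fract f = Fract (s * f) s" by (simp add: to_fract_def eq_fract)
    with s show ?thesis by (auto simp: localized_ideal_def)
  qed
  then show ?thesis by (simp add: symbolic_power_def)
qed

text \<open>
  The infimum defining the defect is attained because \<open>enat\<close> is well-ordered, so defect \<open>0\<close> means
  that the empty set generates the quotient, which is therefore trivial.
\<close>

lemma sdefect_pos:
  assumes "f \<in> symbolic_power J m" "f \<notin> ideal_power J m"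
  shows "sdefect J m > 0"
proof (rule ccontr)
  let ?M = "symbolic_power J m" and ?N = "ideal_power J m"
  let ?S = "{G. finite G \<and> generates_quotient G ?M ?N}"
  assume "\<not> sdefect J m > 0"
  then have zero: "(INF G\<in>?S. enat (card G)) = 0" by (simp add: sdefect_def num_generators_def)
  have "0 \<in> (\<lambda>G. enat (card G)) ` ?S"
  proof -
    \<comment> \<open>The infimum of the empty set is infinite.\<close>
    have "?S \<noteq> {}"
    proof
      assume "?S = {}"
      then have "(INF G\<in>?S. enat (card G)) = \<infinity>" by (simp only: image_empty Inf_empty top_enat_def)
      with zero show False by simp
    qed
    then obtain G where "G \<in> ?S" by blast
    then have "(INF G\<in>?S. enat (card G)) \<in> (\<lambda>G. enat (card G)) ` ?S"
      by (intro wellorder_InfI[of "enat (card G)"] imageI)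
    with zero show ?thesis by simp
  qed
  then have "generates_quotient {} ?M ?N" by (auto simp: zero_enat_def)
  then have "f +o ?N = 0 +o ?N"
    using assms(1) by (auto simp: generates_quotient_def quotient_module_def)
  moreover have "f \<in> f +o ?N"
    using ideal.subspace_0[OF subspace_ideal_power] by (force simp: elt_set_plus_def)
  ultimately show False using assms(2) by simp
qed

section \<open>The coordinate ring of the twisted cubic\<close>

definition Q0 :: "'k::field poly4" where "Q0 = X 2 ^ 2 - X 1 * X 3"
definition Q1 :: "'k::field poly4" where "Q1 = X 1 * X 2 - X 0 * X 3"
definition Q2 :: "'k::field poly4" where "Q2 = X 1 ^ 2 - X 0 * X 2"

lemma gens_I_eq: "gens_I = {Q0, Q1, Q2}"
  by (simp add: gens_I_def Q0_def Q1_def Q2_def)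

lemma ring_map_single: "ring_map (Poly_Mapping.single 0 :: 'k::field \<Rightarrow> 'k poly4)"
  by standard (simp_all add: single_add mult_single)

lemma X_nonzero [simp]: "X i \<noteq> (0 :: 'k::field poly4)"
proof
  assume "X i = (0 :: 'k poly4)"
  then have "eval id (\<lambda>_. 1) (X i) = eval id (\<lambda>_. 1) (0 :: 'k poly4)" by simp
  moreover have "ring_map (id :: 'k \<Rightarrow> 'k)" by standard auto
  ultimately show False by (simp add: eval_X) (simp add: eval_def)
qed

text \<open>
  \<open>X 0\<close> and \<open>X 3\<close> form a regular sequence: substituting \<open>0\<close> for \<open>X 0\<close> detects divisibility
  by \<open>X 0\<close> and leaves \<open>X 3\<close> unchanged.
\<close>

lemma X0_dvd_cofactor:
  assumes "X 3 * b = X 0 * c"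
  shows "X 0 dvd (b :: 'k::field poly4)"
proof -
  let ?e = "eval (Poly_Mapping.single 0) (\<lambda>i. if i = 0 then 0 else X i) :: 'k poly4 \<Rightarrow> 'k poly4"
  interpret e: ring_map ?e by (rule ring_map_eval[OF ring_map_single])
  note eX = eval_X[OF ring_map_single]
  have cong: "X 0 dvd p - ?e p" for p
  proof (induction p rule: poly4_ring_induct)
    case (mult p q)
    have "p * q - ?e (p * q) = (p - ?e p) * q + ?e p * (q - ?e q)"
      by (simp add: e.mult algebra_simps)
    with mult show ?case by simp
  next
    case (add p q)
    have "p + q - ?e (p + q) = (p - ?e p) + (q - ?e q)" by (simp add: e.add)
    with add show ?case by (simp only: dvd_add)
  qed (simp_all add: eX eval_const[OF ring_map_single])
  have "?e (X 3 * b) = ?e (X 0 * c)" by (simp only: assms)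
  then have "?e b = 0" by (simp add: e.mult eX X_nonzero)
  with cong[of b] show ?thesis by simp
qed

text \<open>
  A nonzero principal ideal is saturated with respect to \<open>X 0\<close> and \<open>X 3\<close>.  The quotients of the
  two multiples of \<open>a\<close> by \<open>G\<close> are proportional to \<open>X 0\<close> and \<open>X 3\<close>, so regularity of
  this sequence provides the quotient of \<open>a\<close> itself.
\<close>

lemma dvd_saturated:
  fixes G :: "'k::field poly4"
  assumes "G \<noteq> 0" "G dvd X 0 * a" "G dvd X 3 * a"
  shows "G dvd a"
proof -
  from assms(2,3) obtain b c where b: "X 0 * a = G * b" and c: "X 3 * a = G * c" unfolding dvd_def by blast
  have "G * (X 3 * b) = X 3 * (X 0 * a)" unfolding b by (simp only: mult_ac)
  also have "\<dots> = X 0 * (X 3 * a)" by (simp only: mult_ac)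
  also have "\<dots> = G * (X 0 * c)" unfolding c by (simp only: mult_ac)
  finally have "X 3 * b = X 0 * c" using assms(1) by simp
  then have "X 0 dvd b" by (rule X0_dvd_cofactor)
  then obtain b' where "b = X 0 * b'" unfolding dvd_def by blast
  with b have "X 0 * a = X 0 * (G * b')" by (simp add: mult.left_commute)
  then show ?thesis by simp
qed

text \<open>
  \<open>Triple a b c\<close> stands for \<open>a + b x\<^sub>1 + c x\<^sub>2\<close>, and the multiplication below is obtained from
  \<open>x\<^sub>1\<^sup>2 = x\<^sub>0 x\<^sub>2\<close>, \<open>x\<^sub>1 x\<^sub>2 = x\<^sub>0 x\<^sub>3\<close>, \<open>x\<^sub>2\<^sup>2 = x\<^sub>1 x\<^sub>3\<close>.  The entries range over the whole
  polynomial ring instead of \<open>K[x\<^sub>0, x\<^sub>3]\<close>: this spares a second polynomial ring and an embedding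
  of it, and the ring \<open>S/I\<close> is recovered as the image of the homomorphism \<open>coords\<close>.
\<close>

context notes [[typedef_overloaded]]
begin

datatype 'k::zero triple = Triple (c0: "'k poly4") (c1: "'k poly4") (c2: "'k poly4")

end

instantiation triple :: (field) comm_ring_1
begin

definition "0 = Triple 0 0 0"
definition "1 = Triple 1 0 0"
definition "s + t = Triple (c0 s + c0 t) (c1 s + c1 t) (c2 s + c2 t)"
definition "s - t = Triple (c0 s - c0 t) (c1 s - c1 t) (c2 s - c2 t)"
definition "- t = Triple (- c0 t) (- c1 t) (- c2 t)"
definition "s * t = Triple
  (c0 s * c0 t + X 0 * X 3 * (c1 s * c2 t + c2 s * c1 t))
  (c0 s * c1 t + c1 s * c0 t + X 3 * c2 s * c2 t)
  (c0 s * c2 t + c2 s * c0 t + X 0 * c1 s * c1 t)"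

lemmas triple_defs = zero_triple_def one_triple_def plus_triple_def minus_triple_def
  uminus_triple_def times_triple_def

instance
  by standard (simp_all add: triple_defs, simp_all add: algebra_simps)

end

definition coords :: "'k::field poly4 \<Rightarrow> 'k triple" where
  "coords = eval (\<lambda>a. Triple (Poly_Mapping.single 0 a) 0 0)
     (\<lambda>i. if i = 1 then Triple 0 1 0 else if i = 2 then Triple 0 0 1 else Triple (X i) 0 0)"

definition of_coords :: "'k::field triple \<Rightarrow> 'k poly4" where
  "of_coords t = c0 t + c1 t * X 1 + c2 t * X 2"

lemma ring_map_Triple: "ring_map (\<lambda>a::'k::field. Triple (Poly_Mapping.single 0 a) 0 0)"
  by standard (simp_all add: single_add mult_single triple_defs)

interpretation coords: ring_map coords
  unfolding coords_def by (rule ring_map_eval[OF ring_map_Triple])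

lemma coords_X:
  "coords (X 0) = Triple (X 0) 0 0" "coords (X 1) = Triple 0 1 0"
  "coords (X 2) = Triple 0 0 1" "coords (X 3) = Triple (X 3) 0 0"
  by (simp_all add: coords_def eval_X[OF ring_map_Triple])

lemma coords_Q: "g \<in> gens_I \<Longrightarrow> coords g = 0"
  by (auto simp: gens_I_def coords.simps coords_X power2_eq_square triple_defs)

text \<open>
  The products \<open>x\<^sub>1\<^sup>2\<close>, \<open>x\<^sub>1 x\<^sub>2\<close>, \<open>x\<^sub>2\<^sup>2\<close> were rewritten by relations that hold modulo the three
  quadrics, so \<open>of_coords\<close> is multiplicative modulo \<open>I\<close>.
\<close>

lemma of_coords_mult: "of_coords s * of_coords t - of_coords (s * t) \<in> ideal.span gens_I"
proof -
  have "of_coords s * of_coords t - of_coords (s * t)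
     = c1 s * c1 t * Q2 + (c1 s * c2 t + c2 s * c1 t) * Q1 + c2 s * c2 t * Q0"
    by (simp add: of_coords_def times_triple_def Q0_def Q1_def Q2_def power2_eq_square algebra_simps)
  also have "\<dots> \<in> ideal.span gens_I"
    by (intro ideal.span_add ideal.span_scale ideal.span_base) (auto simp: gens_I_eq)
  finally show ?thesis .
qed

text \<open>
  Consequently \<open>coords\<close> is a normal form: its kernel is exactly the ideal of the twisted cubic.
\<close>

lemma of_coords_coords: "of_coords (coords p) - p \<in> ideal.span gens_I"
proof (induction p rule: poly4_ring_induct)
  case (const a)
  show ?case by (simp add: coords_def eval_const[OF ring_map_Triple] of_coords_def ideal.span_zero)
next
  case (X i)
  show ?case using index_cases[of i] by (auto simp: coords_X of_coords_def ideal.span_zero)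
next
  case (add p q)
  have "of_coords (coords (p + q)) - (p + q) = (of_coords (coords p) - p) + (of_coords (coords q) - q)"
    by (simp add: coords.add of_coords_def plus_triple_def algebra_simps)
  with add show ?case by (simp only: ideal.span_add)
next
  case (mult p q)
  have "of_coords (coords (p * q)) - p * q = of_coords (coords q) * (of_coords (coords p) - p) + p * (of_coords (coords q) - q)
     - (of_coords (coords p) * of_coords (coords q) - of_coords (coords p * coords q))"
    by (simp add: coords.mult algebra_simps)
  also have "\<dots> \<in> ideal.span gens_I"
    by (rule ideal.span_diff[OF ideal.span_add[OF ideal.span_scale[OF mult(1)]
      ideal.span_scale[OF mult(2)]] of_coords_mult])
  finally show ?case .
qed

section \<open>The three ideals are unmixed\<close>

lemma I_D_span:
  "I_D0 d = ideal.span (gens_I \<union> {(X 2 - X 1) * H d})"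
  "I_D1 d = ideal.span (gens_I \<union> {X 2 * H d, X 1 * H d})"
  "I_D2 d = ideal.span (gens_I \<union> {X 2 * H d, X 1 * H d, X 0 * H d})"
  unfolding I_D0_def I_D1_def I_D2_def ideal.span_Un by (auto simp: set_plus_def)

lemma H_eq: "d \<ge> 2 \<Longrightarrow> H d = X 0 * X 0 ^ (d - 2) - X 3 * X 3 ^ (d - 2)"
  by (cases d; cases "d - 1") (auto simp: H_def)

lemma coords_H: "coords (H d) = Triple (H d) 0 0"
proof -
  have "Triple a 0 0 ^ n = Triple (a ^ n) 0 0" for a :: "'a poly4" and n
    by (induction n) (simp_all add: triple_defs)
  then show ?thesis by (simp add: H_def coords.simps coords_X) (simp add: triple_defs)
qed

lemma H_nonzero:
  assumes "d \<ge> 2" shows "H d \<noteq> (0 :: 'k::field poly4)"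
proof
  let ?e = "eval id (\<lambda>i. if i = 0 then 1 else 0) :: 'k poly4 \<Rightarrow> 'k"
  have id: "ring_map (id :: 'k \<Rightarrow> 'k)" by standard auto
  interpret e: ring_map ?e by (rule ring_map_eval[OF id])
  assume "H d = (0 :: 'k poly4)"
  then have "?e (H d) = 0" by (simp add: e.zero)
  then show False using assms by (simp add: H_eq e.simps eval_X[OF id])
qed

text \<open>
  In the basis \<open>1, x\<^sub>1, x\<^sub>2\<close> the ideals \<open>I_D1\<close> and \<open>I_D2\<close> are diagonal: an ideal generated by
  \<open>I\<close> and multiples of \<open>H\<close> that contains \<open>x\<^sub>1 H\<close> and \<open>x\<^sub>2 H\<close> is described by divisibility of each
  coordinate, where only the first coordinate depends on the ideal.
\<close>

lemma mem_span_iff_coords: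
  assumes E: "\<And>p t. p \<in> E \<Longrightarrow> G dvd c0 (coords p * t) \<and> H d dvd c1 (coords p * t) \<and> H d dvd c2 (coords p * t)"
    and G: "G \<in> ideal.span (gens_I \<union> E)"
    and X1: "X 1 * H d \<in> ideal.span (gens_I \<union> E)"
    and X2: "X 2 * H d \<in> ideal.span (gens_I \<union> E)"
  shows "f \<in> ideal.span (gens_I \<union> E) \<longleftrightarrow> G dvd c0 (coords f) \<and> H d dvd c1 (coords f) \<and> H d dvd c2 (coords f)"
proof
  assume "f \<in> ideal.span (gens_I \<union> E)"
  then show "G dvd c0 (coords f) \<and> H d dvd c1 (coords f) \<and> H d dvd c2 (coords f)"
  proof (induction rule: ideal.span_induct_alt)
    case base
    show ?case by (simp add: coords.zero zero_triple_def)
  next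
    case (step c g z)
    have "G dvd c0 (coords (c * g)) \<and> H d dvd c1 (coords (c * g)) \<and> H d dvd c2 (coords (c * g))"
    proof (cases "g \<in> E")
      case True
      then show ?thesis using E[of g "coords c"] by (simp add: coords.mult mult.commute)
    next
      case False
      then have "coords g = 0" using step coords_Q by blast
      then show ?thesis by (simp add: coords.mult) (simp add: zero_triple_def)
    qed
    with step show ?case by (simp add: coords.add plus_triple_def)
  qed
next
  let ?J = "ideal.span (gens_I \<union> E)"
  assume "G dvd c0 (coords f) \<and> H d dvd c1 (coords f) \<and> H d dvd c2 (coords f)"
  then obtain a b c where "c0 (coords f) = G * a" "c1 (coords f) = H d * b" "c2 (coords f) = H d * c"
    unfolding dvd_def by blast
  then have "of_coords (coords f) = a * G + b * (X 1 * H d) + c * (X 2 * H d)"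
    by (simp add: of_coords_def algebra_simps)
  also have "\<dots> \<in> ?J" by (intro ideal.span_add ideal.span_scale G X1 X2)
  finally have "of_coords (coords f) \<in> ?J" .
  moreover have "of_coords (coords f) - f \<in> ?J"
    using of_coords_coords ideal.span_mono[of gens_I "gens_I \<union> E"] by blast
  ultimately show "f \<in> ?J" using ideal.span_diff[of "of_coords (coords f)" _ "of_coords (coords f) - f"] by simp
qed

lemma unmixed_of_coords:
  assumes "d \<ge> 2" "G \<noteq> 0"
    and J: "\<And>f. f \<in> J \<longleftrightarrow> G dvd c0 (coords f) \<and> H d dvd c1 (coords f) \<and> H d dvd c2 (coords f)"
    and "X 0 * h \<in> J" "X 3 * h \<in> J"
  shows "h \<in> J"
proof -
  have "G dvd X 0 * c0 (coords h) \<and> H d dvd X 0 * c1 (coords h) \<and> H d dvd X 0 * c2 (coords h)"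
    "G dvd X 3 * c0 (coords h) \<and> H d dvd X 3 * c1 (coords h) \<and> H d dvd X 3 * c2 (coords h)"
    using assms(4,5) unfolding J by (simp_all add: coords.mult coords_X times_triple_def)
  then show ?thesis
    unfolding J by (simp only: dvd_saturated[OF assms(2), of "c0 (coords h)"]
      dvd_saturated[OF H_nonzero[OF assms(1)], of "c1 (coords h)"]
      dvd_saturated[OF H_nonzero[OF assms(1)], of "c2 (coords h)"])
qed

lemma X0X3_eq: "X 0 * X 3 = X 1 * X 2 - (Q1 :: 'k::field poly4)"
  by (simp add: Q1_def)

text \<open>
  Multiplying \<open>x\<^sub>1 H\<close> by \<open>x\<^sub>2\<close> contributes \<open>x\<^sub>0 x\<^sub>3 H\<close> to the first coordinate, so the ideal
  is cut out by divisibility by \<open>H x\<^sub>0 x\<^sub>3\<close>, \<open>H\<close>, \<open>H\<close>.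
\<close>

lemma unmixed_D1:
  assumes "d \<ge> 2" "X 0 * h \<in> I_D1 d" "X 3 * h \<in> I_D1 d"
  shows "h \<in> I_D1 d"
proof (rule unmixed_of_coords[OF assms(1) _ _ assms(2,3)])
  show "H d * (X 0 * X 3) \<noteq> 0" using H_nonzero[OF assms(1)] by simp
  show "f \<in> I_D1 d \<longleftrightarrow> H d * (X 0 * X 3) dvd c0 (coords f) \<and> H d dvd c1 (coords f) \<and> H d dvd c2 (coords f)" for f
    unfolding I_D_span
  proof (rule mem_span_iff_coords)
    have "H d * (X 0 * X 3) = X 2 * (X 1 * H d) - H d * Q1"
      by (simp add: X0X3_eq algebra_simps)
    also have "\<dots> \<in> ideal.span (gens_I \<union> {X 2 * H d, X 1 * H d})"
      by (intro ideal.span_diff ideal.span_scale ideal.span_base) (auto simp: gens_I_eq)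
    finally show "H d * (X 0 * X 3) \<in> ideal.span (gens_I \<union> {X 2 * H d, X 1 * H d})" .
  qed (auto simp: coords.mult coords_X coords_H times_triple_def intro!: ideal.span_base)
qed

lemma unmixed_D2:
  assumes "d \<ge> 2" "X 0 * h \<in> I_D2 d" "X 3 * h \<in> I_D2 d"
  shows "h \<in> I_D2 d"
proof (rule unmixed_of_coords[OF assms(1) _ _ assms(2,3)])
  show "H d * X 0 \<noteq> 0" using H_nonzero[OF assms(1)] by simp
  show "f \<in> I_D2 d \<longleftrightarrow> H d * X 0 dvd c0 (coords f) \<and> H d dvd c1 (coords f) \<and> H d dvd c2 (coords f)" for f
    unfolding I_D_span
    by (rule mem_span_iff_coords)
       (auto simp: coords.mult coords_X coords_H times_triple_def mult.commute[of "H d" "X 0"] intro!: ideal.span_base)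
qed

lemma coords_F: "coords ((X 2 - X 1) * H d) = Triple 0 (- H d) (H d)"
  by (simp add: coords.simps coords_X coords_H) (simp add: triple_defs)

text \<open>
  The first coordinate of the product says that the last two coordinates of \<open>t\<close> agree; the other
  two say that the first one is \<open>x\<^sub>3\<close> times and \<open>x\<^sub>0\<close> times this common value, which must
  then vanish.
\<close>

lemma coords_F_regular:
  assumes d: "d \<ge> 2" and zero: "Triple 0 (- H d) (H d) * t = (0 :: 'k::field triple)"
  shows "t = 0"
proof -
  have eqs: "c0 t = X 3 * c2 t" "c0 t = X 0 * c1 t" "X 0 * X 3 * (H d * (c1 t - c2 t)) = 0"
    using zero H_nonzero[OF d] by (auto simp: triple_defs algebra_simps)
  then have "c1 t = c2 t" using H_nonzero[OF d, where ?'k = 'k] by simp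
  then have "c2 t * (X 0 - X 3) = 0" using eqs by (simp add: algebra_simps)
  moreover have "X 0 \<noteq> (X 3 :: 'k poly4)" using H_nonzero[of 2, where ?'k = 'k] by (auto simp: H_def)
  ultimately have "c2 t = 0" by simp
  then show ?thesis using eqs \<open>c1 t = c2 t\<close> by (cases t) (simp add: zero_triple_def)
qed

text \<open>
  Here \<open>J/I\<close> is principal, generated by the regular element \<open>F\<close>.  If \<open>x\<^sub>0 h = F s\<close> and
  \<open>x\<^sub>3 h = F t\<close> modulo \<open>I\<close>, cancelling \<open>F\<close> leaves \<open>x\<^sub>3 s = x\<^sub>0 t\<close>; then \<open>x\<^sub>0\<close> divides
  \<open>s\<close> coordinatewise and \<open>h\<close> is a multiple of \<open>F\<close> modulo \<open>I\<close>.
\<close>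

lemma unmixed_D0:
  fixes h :: "'k::field poly4"
  assumes d: "d \<ge> 2" and "X 0 * h \<in> I_D0 d" "X 3 * h \<in> I_D0 d"
  shows "h \<in> I_D0 d"
proof -
  let ?F = "(X 2 - X 1) * H d :: 'k poly4" and ?J = "I_D0 d :: 'k poly4 set"
  have J: "\<exists>g. coords f = coords ?F * g" if "f \<in> ?J" for f
  proof -
    from that obtain p q where "f = p + q" "p \<in> ideal.span gens_I" "q \<in> ideal.span {?F}"
      unfolding I_D0_def by (auto simp: set_plus_def)
    moreover have "coords p = 0" using \<open>p \<in> ideal.span gens_I\<close>
      by (induction rule: ideal.span_induct_alt) (simp_all add: coords.simps coords_Q)
    ultimately show ?thesis
      by (auto simp: ideal.span_singleton coords.add coords.mult mult.commute[of "coords _" "_ * _"])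
  qed
  obtain s t where s: "coords (X 0) * coords h = coords ?F * s" and t: "coords (X 3) * coords h = coords ?F * t"
    using J[OF assms(2)] J[OF assms(3)] by (auto simp: coords.mult)
  have "coords ?F * (coords (X 3) * s - coords (X 0) * t) = coords (X 3) * (coords ?F * s) - coords (X 0) * (coords ?F * t)"
    by (simp add: algebra_simps)
  also have "\<dots> = 0" unfolding s[symmetric] t[symmetric] by (simp add: mult.left_commute)
  finally have "coords (X 3) * s = coords (X 0) * t"
    using coords_F_regular[OF d] unfolding coords_F by force
  then have "X 3 * c0 s = X 0 * c0 t" "X 3 * c1 s = X 0 * c1 t" "X 3 * c2 s = X 0 * c2 t"
    by (simp_all add: coords_X times_triple_def)
  then have "X 0 dvd c0 s" "X 0 dvd c1 s" "X 0 dvd c2 s"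
    by (blast intro: X0_dvd_cofactor)+
  then obtain a b c where abc: "c0 s = X 0 * a" "c1 s = X 0 * b" "c2 s = X 0 * c"
    unfolding dvd_def by blast
  define r where "r = Triple a b c"
  have "s = coords (X 0) * r" using abc by (cases s) (simp add: r_def coords_X times_triple_def)
  with s have "coords (X 0) * (coords h - coords ?F * r) = 0" by (simp add: algebra_simps)
  then have "coords h - coords ?F * r = 0"
    by (cases "coords h - coords ?F * r") (simp add: coords_X times_triple_def zero_triple_def)
  then have "h - ?F * of_coords r = of_coords (coords ?F) * of_coords r - ?F * of_coords r
      - (of_coords (coords ?F) * of_coords r - of_coords (coords ?F * r)) - (of_coords (coords h) - h)"
    by simp
  also have "\<dots> = of_coords r * (of_coords (coords ?F) - ?F)
      - (of_coords (coords ?F) * of_coords r - of_coords (coords ?F * r)) - (of_coords (coords h) - h)"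
    by (simp add: algebra_simps)
  also have "\<dots> \<in> ideal.span gens_I"
    by (rule ideal.span_diff[OF ideal.span_diff[OF ideal.span_scale[OF of_coords_coords] of_coords_mult] of_coords_coords])
  finally have "h - ?F * of_coords r \<in> ideal.span gens_I" .
  moreover have "of_coords r * ?F \<in> ideal.span {?F}" by (intro ideal.span_scale ideal.span_base) simp
  ultimately have "(h - ?F * of_coords r) + of_coords r * ?F \<in> ?J"
    unfolding I_D0_def by (rule set_plus_intro)
  then show ?thesis by (simp add: mult.commute[of "of_coords r"])
qed

section \<open>Elements of the symbolic powers\<close>

lemma scaled_products:
  assumes "ideal.subspace J"
  shows "a \<in> J \<Longrightarrow> b \<in> J \<Longrightarrow> r * (a * b) \<in> ideal_power J 2"
    and "a \<in> J \<Longrightarrow> b \<in> J \<Longrightarrow> c \<in> J \<Longrightarrow> r * (a * b * c) \<in> ideal_power J 3"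
  by (simp_all add: ideal_power_2 ideal_power_3 ideal.subspace_scale[OF subspace_ideal_power])

lemmas ideal_power_arith =
  ideal.subspace_add[OF subspace_ideal_power] ideal.subspace_diff[OF subspace_ideal_power]

text \<open>
  The product \<open>F e\<close> with \<open>F = (x\<^sub>2 - x\<^sub>1) H\<close>, because \<open>(x\<^sub>2 - x\<^sub>1) e\<close> is the class of
  \<open>(x\<^sub>1 - x\<^sub>0) Q\<^sub>0\<close>.  Each \<open>x\<^sub>i F e\<close> is then \<open>F\<close> times an element of \<open>I\<close> modulo \<open>I\<^sup>2\<close>,
  as needed for the square of \<open>I_D0\<close>.
\<close>

definition witness_D0 :: "nat \<Rightarrow> 'k::field poly4" where
  "witness_D0 d = H d * (X 1 - X 0) * Q0"

text \<open>
  On the curve, \<open>x\<^sub>1 x\<^sub>2 H\<^sup>3\<close> vanishes exactly three times on the divisor of \<open>I_D1\<close>, but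
  at the two points \<open>t = 0\<close> and \<open>s = 0\<close> it must be corrected by an element of \<open>I\<close>.  The
  correction \<open>H\<^sup>2 (x\<^sub>0\<^sup>d\<^sup>-\<^sup>1 (Q\<^sub>1 - e) - x\<^sub>3\<^sup>d\<^sup>-\<^sup>1 e)\<close> works at both of them: its two terms
  use \<open>x\<^sub>0 (Q\<^sub>1 - e) = x\<^sub>1 Q\<^sub>2\<close> and \<open>x\<^sub>3 e = x\<^sub>2 Q\<^sub>0\<close>.
\<close>

definition witness_D1 :: "nat \<Rightarrow> 'k::field poly4" where
  "witness_D1 d = X 1 * X 2 * H d ^ 3
     + H d ^ 2 * (X 0 ^ (d - 2) * X 1 * Q2 - X 3 ^ (d - 2) * X 2 * Q0)"

text \<open>
  Here \<open>x\<^sub>0 H\<^sup>2\<close> is \<open>(x\<^sub>0 H)\<^sup>2\<close> up to a unit where \<open>x\<^sub>0 \<noteq> 0\<close>.  At the remaining point \<open>s = 0\<close>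
  of the curve one has \<open>x\<^sub>0 x\<^sub>3 = x\<^sub>1 x\<^sub>2 - Q\<^sub>1\<close>, and the term with \<open>Q\<^sub>1\<close> has to be cancelled.
  This is achieved by \<open>x\<^sub>3\<^sup>d\<^sup>-\<^sup>2 H (Q\<^sub>1 - e)\<close>, where \<open>H (Q\<^sub>1 - e)\<close> is written out with
  \<open>x\<^sub>0 (Q\<^sub>1 - e) = x\<^sub>1 Q\<^sub>2\<close> and \<open>x\<^sub>3 (Q\<^sub>1 - e) = x\<^sub>3 Q\<^sub>1 - x\<^sub>2 Q\<^sub>0\<close>.
\<close>

definition witness_D2 :: "nat \<Rightarrow> 'k::field poly4" where
  "witness_D2 d = X 0 * H d ^ 2
     - X 3 ^ (d - 2) * (X 0 ^ (d - 2) * X 1 * Q2 - X 3 ^ (d - 2) * (X 3 * Q1 - X 2 * Q0))"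

lemma subspace_I_D [simp]: "ideal.subspace (I_D0 d)" "ideal.subspace (I_D1 d)" "ideal.subspace (I_D2 d)"
  by (simp_all add: I_D_span)

lemma Q_in_I_D [simp]:
  "Q0 \<in> I_D0 d" "Q1 \<in> I_D0 d" "Q2 \<in> I_D0 d"
  "Q0 \<in> I_D1 d" "Q1 \<in> I_D1 d" "Q2 \<in> I_D1 d"
  "Q0 \<in> I_D2 d" "Q1 \<in> I_D2 d" "Q2 \<in> I_D2 d"
  by (auto simp: I_D_span gens_I_eq intro!: ideal.span_base)

lemma XH_in_I_D [simp]:
  "(X 2 - X 1) * H d \<in> I_D0 d"
  "X 1 * H d \<in> I_D1 d" "X 2 * H d \<in> I_D1 d"
  "X 0 * H d \<in> I_D2 d" "X 1 * H d \<in> I_D2 d" "X 2 * H d \<in> I_D2 d"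
  by (auto simp: I_D_span gens_I_eq intro!: ideal.span_base)

text \<open>
  The six memberships below are certified by polynomial identities that use nothing about \<open>H\<close>
  except \<open>H = x\<^sub>0 a - x\<^sub>3 b\<close> with \<open>a = x\<^sub>0 ^ (d - 2)\<close> and \<open>b = x\<^sub>3 ^ (d - 2)\<close>; each summand
  displays as many factors from the ideal as the exponent requires.
\<close>

lemma X0_witness_D0: "X 0 * witness_D0 d \<in> (ideal_power (I_D0 d) 2 :: 'k::field poly4 set)"
proof -
  let ?F = "(X 2 - X 1) * H d :: 'k poly4"
  have "X 0 * witness_D0 d
      = X 0 * (?F * Q1) - X 1 * (?F * Q2) + H d * (Q1 * Q2) - H d * (Q2 * Q2)"
    by (simp add: witness_D0_def Q0_def Q1_def Q2_def power2_eq_square algebra_simps)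
  then show ?thesis by (auto intro!: ideal_power_arith scaled_products)
qed

lemma X3_witness_D0: "X 3 * witness_D0 d \<in> (ideal_power (I_D0 d) 2 :: 'k::field poly4 set)"
proof -
  let ?F = "(X 2 - X 1) * H d :: 'k poly4"
  have "X 3 * witness_D0 d = X 2 * (?F * Q0) + H d * (Q0 * Q1) - H d * (Q0 * Q0)"
    by (simp add: witness_D0_def Q0_def Q1_def Q2_def power2_eq_square algebra_simps)
  then show ?thesis by (auto intro!: ideal_power_arith scaled_products)
qed

lemma X0_witness_D1:
  assumes "d \<ge> 2" shows "X 0 ^ 2 * witness_D1 d \<in> (ideal_power (I_D1 d) 3 :: 'k::field poly4 set)"
proof -
  define a b h y z :: "'k poly4" where "a = X 0 ^ (d - 2)" and "b = X 3 ^ (d - 2)" and "h = H d"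
    and "y = X 1 * h" and "z = X 2 * h"
  note defs = a_def b_def h_def y_def z_def
  have h: "h = X 0 * a - X 3 * b" using H_eq[OF assms] by (simp add: defs)
  have "X 0 ^ 2 * (X 1 * X 2 * h ^ 3 + h ^ 2 * (a * X 1 * Q2 - b * X 2 * Q0))
      = X 0 * (y * y * y) + b * X 1 * (y * z * Q2) - b * h * (y * Q1 * Q2)
        - X 0 * b * (y * z * Q1) + X 0 * b * (z * z * Q2)"
    unfolding y_def z_def h Q0_def Q1_def Q2_def
    by (simp add: power2_eq_square power3_eq_cube algebra_simps)
  moreover have "y \<in> I_D1 d" "z \<in> I_D1 d" by (simp_all add: defs)
  ultimately show ?thesis
    unfolding witness_D1_def defs(1,2,3)[symmetric]
    by (auto intro!: ideal_power_arith scaled_products)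
qed

text \<open>
  The image of the preceding identity under the symmetry that reverses the order of the variables:
  it exchanges \<open>Q\<^sub>0\<close> with \<open>Q\<^sub>2\<close>, \<open>a\<close> with \<open>b\<close>, and changes the sign of \<open>H\<close> and of the
  witness.
\<close>

lemma X3_witness_D1:
  assumes "d \<ge> 2" shows "X 3 ^ 2 * witness_D1 d \<in> (ideal_power (I_D1 d) 3 :: 'k::field poly4 set)"
proof -
  define a b h y z :: "'k poly4" where "a = X 0 ^ (d - 2)" and "b = X 3 ^ (d - 2)" and "h = H d"
    and "y = X 1 * h" and "z = X 2 * h"
  note defs = a_def b_def h_def y_def z_def
  have h: "h = X 0 * a - X 3 * b" using H_eq[OF assms] by (simp add: defs)
  have "X 3 ^ 2 * (X 1 * X 2 * h ^ 3 + h ^ 2 * (a * X 1 * Q2 - b * X 2 * Q0))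
      = X 3 * (z * z * z) - a * X 2 * (y * z * Q0) + a * h * (z * Q0 * Q1)
        + X 3 * a * (y * z * Q1) - X 3 * a * (y * y * Q0)"
    unfolding y_def z_def h Q0_def Q1_def Q2_def
    by (simp add: power2_eq_square power3_eq_cube algebra_simps)
  moreover have "y \<in> I_D1 d" "z \<in> I_D1 d" by (simp_all add: defs)
  ultimately show ?thesis
    unfolding witness_D1_def defs(1,2,3)[symmetric]
    by (auto intro!: ideal_power_arith scaled_products)
qed

lemma X0_witness_D2:
  assumes "d \<ge> 2" shows "X 0 * witness_D2 d \<in> (ideal_power (I_D2 d) 2 :: 'k::field poly4 set)"
proof -
  define a b h x y :: "'k poly4" where "a = X 0 ^ (d - 2)" and "b = X 3 ^ (d - 2)" and "h = H d"
    and "x = X 0 * h" and "y = X 1 * h"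
  note defs = a_def b_def h_def x_def y_def
  have h: "h = X 0 * a - X 3 * b" using H_eq[OF assms] by (simp add: defs)
  have "X 0 * (X 0 * h ^ 2 - b * (a * X 1 * Q2 - b * (X 3 * Q1 - X 2 * Q0)))
      = 1 * (x * x) - b * (y * Q2) - b ^ 2 * (Q1 * Q1) + b ^ 2 * (Q0 * Q2)"
    unfolding x_def y_def h Q0_def Q1_def Q2_def
    by (simp add: power2_eq_square algebra_simps)
  moreover have "x \<in> I_D2 d" "y \<in> I_D2 d" by (simp_all add: defs)
  ultimately show ?thesis
    unfolding witness_D2_def defs(1,2,3)[symmetric]
    by (simp only:) (intro ideal_power_arith scaled_products, simp_all)
qed

lemma X3_witness_D2:
  assumes "d \<ge> 2" shows "X 3 * witness_D2 d \<in> (ideal_power (I_D2 d) 2 :: 'k::field poly4 set)"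
proof -
  define a b h x y z :: "'k poly4" where "a = X 0 ^ (d - 2)" and "b = X 3 ^ (d - 2)" and "h = H d"
    and "x = X 0 * h" and "y = X 1 * h" and "z = X 2 * h"
  note defs = a_def b_def h_def x_def y_def z_def
  have h: "h = X 0 * a - X 3 * b" using H_eq[OF assms] by (simp add: defs)
  have "X 3 * (X 0 * h ^ 2 - b * (a * X 1 * Q2 - b * (X 3 * Q1 - X 2 * Q0)))
      = 1 * (y * z) - a * (x * Q1) + b * (z * Q0) - a * b * (Q1 * Q1) + a * b * (Q0 * Q2)"
    unfolding x_def y_def z_def h Q0_def Q1_def Q2_def
    by (simp add: power2_eq_square algebra_simps)
  moreover have "x \<in> I_D2 d" "y \<in> I_D2 d" "z \<in> I_D2 d" by (simp_all add: defs)
  ultimately show ?thesis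
    unfolding witness_D2_def defs(1,2,3)[symmetric]
    by (simp only:) (intro ideal_power_arith scaled_products, simp_all)
qed

lemma symbolic_power_mult_powerI:
  fixes J :: "'a::idom set"
  assumes "\<And>h. x * h \<in> J \<Longrightarrow> y * h \<in> J \<Longrightarrow> h \<in> J" and g: "g \<in> J"
    and x: "x ^ i * f \<in> ideal_power J n" and y: "y ^ i * f \<in> ideal_power J n"
  shows "g ^ k * f \<in> symbolic_power J (k + n)"
proof (rule symbolic_powerI)
  show "x ^ i * (g ^ k * f) \<in> ideal_power J (k + n)" "y ^ i * (g ^ k * f) \<in> ideal_power J (k + n)"
    using ideal_power_mult[OF g x, of k] ideal_power_mult[OF g y, of k]
    by (simp_all add: mult.left_commute)
qed (fact assms(1))

lemma symbolic_witness_D0: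
  "d \<ge> 2 \<Longrightarrow> ((X 2 - X 1) * H d) ^ k * witness_D0 d \<in> symbolic_power (I_D0 d) (k + 2)"
  by (rule symbolic_power_mult_powerI[OF unmixed_D0, where x = "X 0" and y = "X 3" and i = 1])
    (simp_all add: X0_witness_D0 X3_witness_D0)

lemma symbolic_witness_D1:
  "d \<ge> 2 \<Longrightarrow> (X 1 * H d) ^ k * witness_D1 d \<in> symbolic_power (I_D1 d) (k + 3)"
  by (rule symbolic_power_mult_powerI[OF unmixed_D1, where x = "X 0" and y = "X 3" and i = 2])
    (simp_all add: X0_witness_D1 X3_witness_D1)

lemma symbolic_witness_D2:
  "d \<ge> 2 \<Longrightarrow> (X 0 * H d) ^ k * witness_D2 d \<in> symbolic_power (I_D2 d) (k + 2)"
  by (rule symbolic_power_mult_powerI[OF unmixed_D2, where x = "X 0" and y = "X 3" and i = 1])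
    (simp_all add: X0_witness_D2 X3_witness_D2)

section \<open>Restriction to lines through points of the cubic\<close>

definition cubic_point :: "'k::field \<Rightarrow> 4 \<Rightarrow> 'k" where
  "cubic_point c i = (if i = 0 then 1 else if i = 1 then c else if i = 2 then c ^ 2 else c ^ 3)"

text \<open>
  The pullback of polynomials along the line \<open>x \<mapsto> (x, c x, c\<^sup>2 x, c\<^sup>3 x)\<close>.  It suffices for all
  degree comparisons, since forms of degree \<open>n\<close> become multiples of \<open>x ^ n\<close>.
\<close>

definition line :: "'k::field \<Rightarrow> 'k poly4 \<Rightarrow> 'k poly" where
  "line c = eval (\<lambda>a. [:a:]) (\<lambda>i. monom (cubic_point c i) 1)"

lemma ring_map_const_poly: "ring_map (\<lambda>a::'r::comm_ring_1. [:a:])"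
  by standard (simp_all add: one_pCons)

interpretation line: ring_map "line c"
  unfolding line_def by (rule ring_map_eval[OF ring_map_const_poly])

lemma line_X:
  "line c (X 0) = monom 1 1" "line c (X 1) = monom c 1"
  "line c (X 2) = monom (c ^ 2) 1" "line c (X 3) = monom (c ^ 3) 1"
  by (simp_all add: line_def eval_X[OF ring_map_const_poly] cubic_point_def)

lemma line_Q [simp]: "line c Q0 = 0" "line c Q1 = 0" "line c Q2 = 0"
  by (simp_all add: Q0_def Q1_def Q2_def line.simps line_X mult_monom monom_power
      power2_eq_square power3_eq_cube)

lemma line_H: "line c (H d) = monom (1 - (c ^ 3) ^ (d - 1)) (d - 1)"
  by (simp add: H_def line.simps line_X monom_power diff_monom)

lemma line_XH:
  assumes "d \<ge> 2"
  shows "line c (X 0 * H d) = monom (1 - (c ^ 3) ^ (d - 1)) d"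
    and "line c (X 1 * H d) = monom (c * (1 - (c ^ 3) ^ (d - 1))) d"
    and "line c (X 2 * H d) = monom (c ^ 2 * (1 - (c ^ 3) ^ (d - 1))) d"
  using assms by (simp_all add: line.mult line_X line_H mult_monom)

lemma monom_dvd_monom: "a \<noteq> 0 \<Longrightarrow> monom 1 m dvd monom (a::'k::field) n \<Longrightarrow> m \<le> n"
  by (metis coeff_monom monom_1_dvd_iff' not_le)

lemma monom_dvd: "m \<le> n \<Longrightarrow> monom 1 m dvd monom (a::'k::field) n"
  by (auto simp: monom_1_dvd_iff')

lemma dvd_line_ideal_power:
  assumes "\<And>g. g \<in> G \<Longrightarrow> monom 1 d dvd line c g" and "f \<in> ideal_power (ideal.span (gens_I \<union> G)) m"
  shows "monom 1 (d * m) dvd line c f"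
proof -
  have "monom 1 d ^ m dvd line c f"
    by (rule dvd_ideal_power[OF line.ring_map_axioms _ assms(2)]) (auto simp: gens_I_eq assms(1))
  then show ?thesis by (simp add: monom_power)
qed

text \<open>
  The conditions on \<open>c\<close> say that none of \<open>x\<^sub>1\<close>, \<open>x\<^sub>2\<close>, \<open>H\<close> vanishes identically on the line.  Hence the
  element restricts to a monomial whose degree \<open>d * k + 3 * d - 1\<close> is one less than the smallest
  degree that the power of the ideal allows.
\<close>

lemma witness_D1_notin:
  fixes c :: "'k::field"
  assumes "d \<ge> 2" "c \<noteq> 0" "(c ^ 3) ^ (d - 1) \<noteq> 1"
  shows "(X 1 * H d) ^ k * witness_D1 d \<notin> ideal_power (I_D1 d :: 'k poly4 set) (k + 3)"
proof
  let ?h = "1 - (c ^ 3) ^ (d - 1)"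
  assume "(X 1 * H d) ^ k * witness_D1 d \<in> ideal_power (I_D1 d :: 'k poly4 set) (k + 3)"
  then have "monom 1 (d * (k + 3)) dvd line c ((X 1 * H d) ^ k * witness_D1 d)"
    unfolding I_D_span
    by (rule dvd_line_ideal_power[rotated]) (auto simp: line_XH[OF assms(1)] monom_dvd)
  also have "line c ((X 1 * H d) ^ k * witness_D1 d)
      = line c (X 1 * H d) ^ k * (line c (X 1) * line c (X 2) * line c (H d) ^ 3)"
    by (simp add: witness_D1_def line.simps)
  also have "\<dots> = monom ((c * ?h) ^ k * (c * c ^ 2 * ?h ^ 3)) (d * k + (2 + (d - 1) * 3))"
    unfolding line_XH[OF assms(1)] line_H line_X monom_power mult_monom by simp
  finally have "d * (k + 3) \<le> d * k + (2 + (d - 1) * 3)"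
    by (rule monom_dvd_monom[rotated]) (use assms in auto)
  then show False using assms(1) by (cases d) (auto simp: algebra_simps)
qed

text \<open>
  The same comparison on the line \<open>c = 0\<close>, where \<open>x\<^sub>1, x\<^sub>2, x\<^sub>3\<close> vanish and \<open>x\<^sub>0\<close> does not.
\<close>

lemma witness_D2_notin:
  assumes "d \<ge> 2"
  shows "(X 0 * H d) ^ k * witness_D2 d \<notin> ideal_power (I_D2 d :: 'k::field poly4 set) (k + 2)"
proof
  assume "(X 0 * H d) ^ k * witness_D2 d \<in> ideal_power (I_D2 d :: 'k poly4 set) (k + 2)"
  then have "monom 1 (d * (k + 2)) dvd line 0 ((X 0 * H d) ^ k * witness_D2 d :: 'k poly4)"
    unfolding I_D_span
    by (rule dvd_line_ideal_power[rotated]) (auto simp: line_XH[OF assms(1)] monom_dvd)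
  also have "line 0 ((X 0 * H d) ^ k * witness_D2 d :: 'k poly4)
      = line 0 (X 0 * H d) ^ k * (line 0 (X 0) * line 0 (H d) ^ 2)"
    by (simp add: witness_D2_def line.simps)
  also have "\<dots> = monom 1 (d * k + (1 + (d - 1) * 2))"
    unfolding line_XH[OF assms(1)] line_H line_X monom_power mult_monom
    using assms by (simp add: power_0_left)
  finally have "d * (k + 2) \<le> d * k + (1 + (d - 1) * 2)"
    by (rule monom_dvd_monom[rotated]) simp
  then show False using assms(1) by (cases d) (auto simp: algebra_simps)
qed

section \<open>Derivations along lines and the square of the ideal of the cubic\<close>

text \<open>
  The outer variable of the target serves as an infinitesimal: its coefficient at degree zero is
  the restriction to the line, and the one at degree one is the derivative in the constant
  direction \<open>v\<close> at the points of the line.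
\<close>

definition jet :: "'k::field \<Rightarrow> (4 \<Rightarrow> 'k) \<Rightarrow> 'k poly4 \<Rightarrow> 'k poly poly" where
  "jet c v = eval (\<lambda>a. [:[:a:]:]) (\<lambda>i. [:monom (cubic_point c i) 1, [:v i:]:])"

lemma ring_map_const_poly2: "ring_map (\<lambda>a::'r::comm_ring_1. [:[:a:]:])"
  by standard (simp_all add: one_pCons)

interpretation jet: ring_map "jet c v"
  unfolding jet_def by (rule ring_map_eval[OF ring_map_const_poly2])

lemma coeff_jet_0: "coeff (jet c v p) 0 = line c p"
proof (induction p rule: poly4_ring_induct)
  case (const a)
  show ?case by (simp add: jet_def line_def eval_const[OF ring_map_const_poly2] eval_const[OF ring_map_const_poly])
next
  case (X i)
  show ?case by (simp add: jet_def line_def eval_X[OF ring_map_const_poly2] eval_X[OF ring_map_const_poly])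
qed (simp_all add: jet.simps line.simps coeff_mult_0)

definition deriv_along :: "'k::field \<Rightarrow> (4 \<Rightarrow> 'k) \<Rightarrow> 'k poly4 \<Rightarrow> 'k poly" where
  "deriv_along c v p = coeff (jet c v p) 1"

lemma deriv_along_X: "deriv_along c v (X i) = [:v i:]"
  by (simp add: deriv_along_def jet_def eval_X[OF ring_map_const_poly2])

lemma deriv_along_simps:
  "deriv_along c v 0 = 0"
  "deriv_along c v (p + q) = deriv_along c v p + deriv_along c v q"
  "deriv_along c v (p - q) = deriv_along c v p - deriv_along c v q"
  "deriv_along c v (p * q) = line c p * deriv_along c v q + deriv_along c v p * line c q"
  by (simp_all add: deriv_along_def jet.simps coeff_mult flip: coeff_jet_0[of c v])

lemma ideal_power_1: "ideal.subspace J \<Longrightarrow> ideal_power J 1 = J"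
proof -
  assume J: "ideal.subspace J"
  have "{a * b |a b. a \<in> J \<and> b \<in> UNIV} = J"
    using ideal.subspace_scale[OF J] by (auto simp: mult.commute) (metis mult_1_right)
  with J show ?thesis by (simp add: ideal.span_eq_iff)
qed

lemma line_I: "p \<in> ideal.span gens_I \<Longrightarrow> line c p = 0"
  by (induction rule: ideal.span_induct_alt) (auto simp: line.simps gens_I_eq)

lemma deriv_along_I_sq:
  fixes u :: "'k::field poly4"
  assumes "u \<in> ideal_power (ideal.span gens_I) 2"
  shows "line c u = 0" "deriv_along c v u = 0"
proof -
  have "u \<in> ideal.span {a * b |a b. a \<in> ideal.span gens_I \<and> b \<in> ideal.span gens_I}"
    using assms ideal_power_1[OF ideal.subspace_span, of "gens_I :: 'k poly4 set"]
    by (simp only: numeral_2_eq_2 One_nat_def ideal_power.simps(2)[of _ "Suc 0"])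
  then have "line c u = 0 \<and> deriv_along c v u = 0"
  proof (induction rule: ideal.span_induct_alt)
    case (step r ab z)
    then show ?case by (auto simp: line.simps deriv_along_simps line_I)
  qed (simp add: line.zero deriv_along_simps)
  then show "line c u = 0" "deriv_along c v u = 0" by auto
qed

lemma deriv_along_I:
  assumes "a = r * Q0 + s * Q1 + t * Q2"
  shows "deriv_along c v a
    = line c r * deriv_along c v Q0 + line c s * deriv_along c v Q1 + line c t * deriv_along c v Q2"
  by (simp add: assms deriv_along_simps)

lemma span_gens_I_obtain:
  assumes "a \<in> ideal.span gens_I"
  obtains r s t where "a = r * Q0 + s * Q1 + t * Q2"
proof -
  from assms have "\<exists>r s t. a = r * Q0 + s * Q1 + t * Q2"
    unfolding gens_I_eq by (auto simp: ideal.span_breakdown_eq algebra_simps)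
  then show thesis using that by blast
qed

text \<open>
  In the binomial expansion of \<open>(I + \<langle>F\<rangle>) ^ (k + 1)\<close> all terms except the last two have at least
  two factors from \<open>I\<close>.
\<close>

lemma ideal_power_add_principal:
  fixes I :: "'a::comm_ring_1 set"
  assumes I: "ideal.subspace I" and x: "x \<in> ideal_power (I + ideal.span {F}) (Suc k)"
  shows "\<exists>u\<in>ideal_power I 2. \<exists>a\<in>I. \<exists>g. x = u + a * F ^ k + g * F ^ Suc k"
proof -
  let ?J = "I + ideal.span {F}"
  note I2 = subspace_ideal_power[of I 2]
  \<comment> \<open>Elements of the asserted shape form an ideal, so products of generators suffice.\<close>
  define T where "T k = {u + a * F ^ k + g * F ^ Suc k | u a g. u \<in> ideal_power I 2 \<and> a \<in> I}" for k
  have sub: "ideal.subspace (T k)" for k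
  proof (rule ideal.subspaceI)
    show "0 \<in> T k" unfolding T_def
      using ideal.subspace_0[OF I] ideal.subspace_0[OF I2]
      by (intro CollectI exI[of _ 0] conjI) simp_all
    fix x y r assume "x \<in> T k"
    then obtain u a g where x: "x = u + a * F ^ k + g * F ^ Suc k" "u \<in> ideal_power I 2" "a \<in> I"
      by (auto simp: T_def)
    have "r * x = r * u + (r * a) * F ^ k + (r * g) * F ^ Suc k" by (simp add: x algebra_simps)
    moreover have "r * u \<in> ideal_power I 2" "r * a \<in> I"
      using x ideal.subspace_scale I I2 by blast+
    ultimately show "r * x \<in> T k" unfolding T_def by blast
    assume "y \<in> T k"
    then obtain u' a' g' where y: "y = u' + a' * F ^ k + g' * F ^ Suc k" "u' \<in> ideal_power I 2" "a' \<in> I"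
      by (auto simp: T_def)
    have "x + y = (u + u') + (a + a') * F ^ k + (g + g') * F ^ Suc k" by (simp add: x y algebra_simps)
    moreover have "u + u' \<in> ideal_power I 2" "a + a' \<in> I"
      using x y ideal.subspace_add I I2 by blast+
    ultimately show "x + y \<in> T k" unfolding T_def by blast
  qed
  have J: "ideal.subspace ?J"
  proof -
    have span_I: "ideal.span I = I" using I by simp
    have "?J = ideal.span (I \<union> {F})"
      unfolding ideal.span_Un span_I by (auto simp: set_plus_def)
    then show ?thesis by simp
  qed
  have "ideal_power ?J (Suc k) \<subseteq> T k"
  proof (induction k)
    case 0
    show ?case
    proof
      fix x assume "x \<in> ideal_power ?J (Suc 0)"
      then have "x \<in> ?J" using ideal_power_1[OF J] by (simp only: One_nat_def)
      then obtain a g where "a \<in> I" "x = 0 + a * F ^ 0 + g * F ^ Suc 0"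
        by (auto simp: set_plus_def ideal.span_singleton)
      then show "x \<in> T 0" unfolding T_def using ideal.subspace_0[OF I2] by blast
    qed
  next
    case (Suc k)
    have "{a * b |a b. a \<in> ?J \<and> b \<in> ideal_power ?J (Suc k)} \<subseteq> T (Suc k)"
    proof safe
      fix y z assume "y \<in> ?J" and "z \<in> ideal_power ?J (Suc k)"
      then obtain i r where y: "y = i + r * F" "i \<in> I"
        by (auto simp: set_plus_def ideal.span_singleton)
      have "z \<in> T k" using Suc.IH \<open>z \<in> ideal_power ?J (Suc k)\<close> by (rule subsetD)
      then obtain u a g where z: "z = u + a * F ^ k + g * F ^ Suc k" "u \<in> ideal_power I 2" "a \<in> I"
        unfolding T_def by blast
      have "y * z = (y * u + F ^ k * (i * a)) + (i * g + r * a) * F ^ Suc k + (r * g) * F ^ Suc (Suc k)"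
        by (simp add: y z algebra_simps)
      moreover have "y * u + F ^ k * (i * a) \<in> ideal_power I 2"
        by (rule ideal.subspace_add[OF I2 ideal.subspace_scale[OF I2 z(2)]
          ideal.subspace_scale[OF I2 ideal_power_2[OF y(2) z(3)]]])
      moreover have "i * g + r * a \<in> I"
        using ideal.subspace_scale[OF I y(2), of g] ideal.subspace_scale[OF I z(3), of r] I
        by (simp add: ideal.subspace_add mult.commute)
      ultimately show "y * z \<in> T (Suc k)" unfolding T_def by blast
    qed
    then show ?case
      unfolding ideal_power.simps(2)[of _ "Suc k"] by (rule ideal.span_minimal[OF _ sub])
  qed
  then show ?thesis using x unfolding T_def by blast
qed

text \<open>
  Restricting the equation to the line gives \<open>g = 0\<close> there, because everything else belongs to
  \<open>I\<close>.  Differentiating it then removes \<open>u\<close> and every derivative of \<open>F\<close>, and a common power of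
  \<open>F\<close> cancels.  What is left is the relation \<open>F e = F a\<close> modulo \<open>I\<^sup>2\<close> and modulo terms of higher
  degree, evaluated on the line: the restriction of \<open>(x\<^sub>2 - x\<^sub>1) e\<close> has derivative \<open>c - 1\<close> times
  \<open>x\<close> times that of \<open>Q\<^sub>0\<close>, while \<open>x\<^sub>2 - x\<^sub>1\<close> itself restricts to \<open>c (c - 1) x\<close>.
\<close>

lemma witness_D0_deriv:
  fixes c :: "'k::field"
  assumes d: "d \<ge> 2" and c: "c \<noteq> 0" "(c ^ 3) ^ (d - 1) \<noteq> 1"
    and eq: "((X 2 - X 1) * H d) ^ k * witness_D0 d
      = u + a * ((X 2 - X 1) * H d) ^ Suc k + g * ((X 2 - X 1) * H d) ^ Suc (Suc k)"
    and u: "u \<in> ideal_power (ideal.span gens_I) 2" and a: "a \<in> ideal.span gens_I"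
  shows "coeff (deriv_along c v Q0) 1 = c * coeff (deriv_along c v a) 1"
proof -
  define F where "F = (X 2 - X 1) * (H d :: 'k poly4)"
  define h where "h = 1 - (c ^ 3) ^ (d - 1)"
  have "c \<noteq> 1" using c(2) by auto
  have h: "h \<noteq> 0" using c(2) by (simp add: h_def)
  have line_F: "line c F = monom (c * (c - 1) * h) d"
    using d unfolding F_def
    by (simp add: line.simps line_X line_H mult_monom diff_monom h_def power2_eq_square algebra_simps)
  then have F: "line c F \<noteq> 0" using \<open>c \<noteq> 1\<close> c h by simp
  note eq = eq[folded F_def]
  have "line c g * line c F ^ Suc (Suc k) = line c (F ^ k * witness_D0 d)"
    unfolding eq using line_I[OF a] deriv_along_I_sq[OF u] by (simp add: line.simps)
  also have "\<dots> = 0" by (simp add: witness_D0_def line.simps)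
  finally have g: "line c g = 0" using F by simp
  have "line c F ^ k * deriv_along c v (witness_D0 d) = deriv_along c v (F ^ k * witness_D0 d)"
    by (simp add: deriv_along_simps witness_D0_def line.simps)
  also have "\<dots> = line c F ^ k * (line c F * (deriv_along c v a + deriv_along c v g * line c F))"
    unfolding eq using line_I[OF a] deriv_along_I_sq[OF u] g
    by (simp add: deriv_along_simps line.simps algebra_simps)
  finally have "deriv_along c v (witness_D0 d) = line c F * (deriv_along c v a + deriv_along c v g * line c F)"
    using F by simp
  moreover have "line c (H d * (X 1 - X 0)) = monom ((c - 1) * h) d"
    using d by (simp add: line.simps line_X line_H mult_monom diff_monom h_def algebra_simps)
  then have "deriv_along c v (witness_D0 d) = monom ((c - 1) * h) d * deriv_along c v Q0"
    by (simp only: witness_D0_def deriv_along_simps(4) line_Q mult_zero_right add_0_right)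
  moreover have "line c F = monom ((c - 1) * h) d * [:c:]"
    unfolding line_F by (simp add: smult_monom algebra_simps)
  ultimately have "monom ((c - 1) * h) d * deriv_along c v Q0
      = monom ((c - 1) * h) d * ([:c:] * (deriv_along c v a + deriv_along c v g * line c F))"
    by (simp only: mult.assoc)
  moreover have "monom ((c - 1) * h) d \<noteq> 0" using \<open>c \<noteq> 1\<close> h by simp
  ultimately have "deriv_along c v Q0 = [:c:] * (deriv_along c v a + deriv_along c v g * line c F)"
    using mult_left_cancel by blast
  \<comment> \<open>The restriction of \<open>F\<close> has order \<open>d \<ge> 2\<close>, too large to contribute to degree one.\<close>
  moreover have "coeff (deriv_along c v g * line c F) 1 = 0"
    using d unfolding line_F by (simp add: coeff_mult coeff_monom)
  ultimately show ?thesis by simp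
qed

lemma coeff_line_0: "coeff (line c p) 0 = coeff (line 0 p) 0"
proof (induction p rule: poly4_ring_induct)
  case (const a)
  show ?case by (simp add: line_def eval_const[OF ring_map_const_poly])
next
  case (X i)
  show ?case by (simp add: line_def eval_X[OF ring_map_const_poly])
qed (simp_all add: line.simps coeff_mult_0)

text \<open>
  Let \<open>R, S, T\<close> be the constant terms of the coefficients of \<open>a\<close> with respect to the \<open>Q\<^sub>i\<close>.
  At the point \<open>(1 : b)\<close> of the curve, the derivatives in the directions \<open>x\<^sub>3\<close> and \<open>x\<^sub>0\<close> are,
  up to a nonzero factor, the two components of the embedding of \<open>I/I\<^sup>2\<close>.  So in lowest degree the relation
  reads \<open>(1, 0) = R (b, 0) + S (1, b) + T (0, 1)\<close>.  Since \<open>R, S, T\<close> do not depend on \<open>b\<close>, two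
  points already give a contradiction.
\<close>

lemma witness_D0_notin:
  fixes c c' :: "'k::field"
  assumes d: "d \<ge> 2" and c: "c \<noteq> 0" "(c ^ 3) ^ (d - 1) \<noteq> 1"
    and c': "c' \<noteq> 0" "(c' ^ 3) ^ (d - 1) \<noteq> 1" and "c \<noteq> c'"
  shows "((X 2 - X 1) * H d) ^ k * witness_D0 d \<notin> ideal_power (I_D0 d :: 'k poly4 set) (k + 2)"
proof
  let ?F = "(X 2 - X 1) * H d :: 'k poly4"
  assume "?F ^ k * witness_D0 d \<in> ideal_power (I_D0 d) (k + 2)"
  then have "?F ^ k * witness_D0 d \<in> ideal_power (ideal.span gens_I + ideal.span {?F}) (Suc (Suc k))"
    by (simp only: I_D0_def add_2_eq_Suc')
  from ideal_power_add_principal[OF ideal.subspace_span this]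
  obtain u a g where u: "u \<in> ideal_power (ideal.span gens_I) 2" and a: "a \<in> ideal.span gens_I"
    and eq: "?F ^ k * witness_D0 d = u + a * ?F ^ Suc k + g * ?F ^ Suc (Suc k)" by blast
  from span_gens_I_obtain[OF a] obtain r s t where a_eq: "a = r * Q0 + s * Q1 + t * Q2" .
  define R S T where "R = coeff (line 0 r) 0" and "S = coeff (line 0 s) 0" and "T = coeff (line 0 t) 0"
  have *: "1 = b * R + S \<and> b * S + T = 0" if b: "b \<noteq> 0" "(b ^ 3) ^ (d - 1) \<noteq> 1" for b :: 'k
  proof
    note deriv = witness_D0_deriv[OF d b eq u a, unfolded deriv_along_I[OF a_eq]]
    note low = coeff_line_0[of b]
    have "b * (- 1) = b * - (b * R + S)"
      using deriv[of "\<lambda>i. if i = 3 then 1 else 0"]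
      by (simp add: Q0_def Q1_def Q2_def deriv_along_simps deriv_along_X line_X power2_eq_square
        coeff_mult low R_def S_def T_def algebra_simps)
    then have "- 1 = - (b * R + S)" by (simp only: mult_left_cancel[OF b(1)])
    then show "1 = b * R + S" by (simp only: neg_equal_iff_equal)
    have "b ^ 3 * (b * S + T) = 0"
      using deriv[of "\<lambda>i. if i = 0 then 1 else 0"]
      by (simp add: Q0_def Q1_def Q2_def deriv_along_simps deriv_along_X line_X power2_eq_square
        power3_eq_cube coeff_mult low R_def S_def T_def algebra_simps)
    then show "b * S + T = 0" using b(1) by simp
  qed
  have "(c - c') * S = (c * S + T) - (c' * S + T)" "(c - c') * R = (c * R + S) - (c' * R + S)"
    by (simp_all add: algebra_simps)
  then have "(c - c') * S = 0" "(c - c') * R = 0" using *[OF c] *[OF c'] by simp_all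
  then have "S = 0" "R = 0" using \<open>c \<noteq> c'\<close> by auto
  with *[OF c] show False by simp
qed

section \<open>Positivity of the symbolic defects\<close>

text \<open>
  The product of the \<open>x - a\<close> over all elements of a finite field, plus \<open>1\<close>, has no root.
\<close>

lemma infinite_alg_closed: "infinite (UNIV :: 'k::alg_closed_field set)"
proof
  assume fin: "finite (UNIV :: 'k set)"
  define p where "p = (\<Prod>a\<in>(UNIV :: 'k set). [:- a, 1:])"
  have "degree p = card (UNIV :: 'k set)" by (simp add: p_def degree_prod_eq_sum_degree)
  then have "degree p > 0" using fin by (simp add: card_gt_0_iff)
  then have "degree (p + 1) > 0" by (subst degree_add_eq_left) auto
  then obtain x where "poly (p + 1) x = 0" using alg_closed_imp_poly_has_root by blast
  moreover have "poly p x = 0" using fin by (auto simp: p_def poly_prod intro!: prod_zero)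
  ultimately show False by simp
qed

text \<open>
  The excluded values are the roots of the nonzero polynomial \<open>x (x ^ (3 (d - 1)) - 1)\<close>, whatever
  the characteristic is.
\<close>

lemma infinite_generic_points:
  assumes "d \<ge> 2"
  shows "infinite {c :: 'k::alg_closed_field. c \<noteq> 0 \<and> (c ^ 3) ^ (d - 1) \<noteq> 1}"
proof
  let ?q = "monom 1 1 * (monom 1 (3 * (d - 1)) - 1) :: 'k poly"
  have "coeff (monom 1 (3 * (d - 1)) - 1 :: 'k poly) 0 = - 1" using assms by (simp add: coeff_monom)
  then have "monom 1 (3 * (d - 1)) - 1 \<noteq> (0 :: 'k poly)" by (metis coeff_0 neg_equal_0_iff_equal one_neq_zero)
  then have "?q \<noteq> 0" by simp
  then have "finite {c. poly ?q c = 0}" by (rule poly_roots_finite)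
  moreover assume "finite {c :: 'k. c \<noteq> 0 \<and> (c ^ 3) ^ (d - 1) \<noteq> 1}"
  ultimately have "finite ({c. poly ?q c = 0} \<union> {c :: 'k. c \<noteq> 0 \<and> (c ^ 3) ^ (d - 1) \<noteq> 1})" by simp
  moreover have "{c. poly ?q c = 0} \<union> {c :: 'k. c \<noteq> 0 \<and> (c ^ 3) ^ (d - 1) \<noteq> 1} = UNIV"
    by (auto simp: poly_monom power_mult)
  ultimately have "finite (UNIV :: 'k set)" by (simp only:)
  then show False using infinite_alg_closed by blast
qed

theorem theorem5p3:
  fixes d :: nat
  assumes "d \<ge> 2"
  shows "(\<forall>m\<ge>3. sdefect (I_D1 d :: 'k::alg_closed_field poly4 set) m > 0) \<and>
         (\<forall>m\<ge>2. sdefect (I_D0 d :: 'k poly4 set) m > 0 \<and>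
                 sdefect (I_D2 d :: 'k poly4 set) m > 0)"
proof (intro conjI allI impI)
  let ?C = "{c :: 'k. c \<noteq> 0 \<and> (c ^ 3) ^ (d - 1) \<noteq> 1}"
  have inf: "infinite ?C" by (rule infinite_generic_points[OF assms])
  then obtain c where c: "c \<in> ?C" using infinite_imp_nonempty by blast
  have "infinite (?C - {c})" using inf by simp
  then obtain c' where c': "c' \<in> ?C" "c \<noteq> c'" using infinite_imp_nonempty by blast
  fix m :: nat
  show "sdefect (I_D1 d :: 'k poly4 set) m > 0" if "m \<ge> 3"
  proof -
    have "sdefect (I_D1 d :: 'k poly4 set) (m - 3 + 3) > 0"
      by (rule sdefect_pos[OF symbolic_witness_D1[OF assms] witness_D1_notin[OF assms]])
        (use c in auto)
    then show ?thesis by (simp only: le_add_diff_inverse2[OF that])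
  qed
  show "sdefect (I_D0 d :: 'k poly4 set) m > 0" if "m \<ge> 2"
  proof -
    have "sdefect (I_D0 d :: 'k poly4 set) (m - 2 + 2) > 0"
      by (rule sdefect_pos[OF symbolic_witness_D0[OF assms] witness_D0_notin[OF assms, of c c']])
        (use c c' in auto)
    then show ?thesis by (simp only: le_add_diff_inverse2[OF that])
  qed
  show "sdefect (I_D2 d :: 'k poly4 set) m > 0" if "m \<ge> 2"
  proof -
    have "sdefect (I_D2 d :: 'k poly4 set) (m - 2 + 2) > 0"
      by (rule sdefect_pos[OF symbolic_witness_D2[OF assms] witness_D2_notin[OF assms]])
    then show ?thesis by (simp only: le_add_diff_inverse2[OF that])
  qed
qed

end
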